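(* Let $V=\{a^n : a,n \in \mathbb{N},\ n\ge 2\}$ be the set of pure powers. There is no infinite Hilbert cube contained in $V$; that is, there do not exist a non-negative integer $a_0$ and an infinite sequence of positive integers $a_1, a_2, \ldots$ such that $H(a_0; a_1, a_2, \ldots) \subset V$.
   Context: For an integer $a_0$ and an infinite sequence $a_1,a_2,\dots$, the infinite Hilbert cube is $H(a_0;a_1,a_2,\dots)=\{a_0+\sum_{i\ge 1}\varepsilon_i a_i : \varepsilon_i\in\{0,1\},\ \text{only finitely many } \varepsilon_i \ne 0\}$ when $a_0\neq 0$; when $a_0=0$ additionally the empty sum is excluded, i.e. one requires $0<\sum_i \varepsilon_i<\infty$. *)

theory Defs
  imports Main
begin

(* Here nat includes 0, so 0 is a pure power; it makes no difference below, since a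
   Hilbert cube with a0 >= 0 and positive generators never contains 0. *)
definition pure_powers :: "int set" where
  "pure_powers = {int a ^ n | a n :: nat. n \<ge> 2}"

(* Only the values a i and eps i with i >= 1 matter; the base point is the separate
   argument a0. Sums run over the support of eps, since sum over an infinite set is 0. *)
definition hilbert_cube :: "int \<Rightarrow> (nat \<Rightarrow> int) \<Rightarrow> int set" where
  "hilbert_cube a0 a =
    {a0 + (\<Sum>i\<in>{i. i \<ge> 1 \<and> eps i \<noteq> 0}. eps i * a i) | eps :: nat \<Rightarrow> int.
       (\<forall>i\<ge>1. eps i \<in> {0, 1}) \<and> finite {i. i \<ge> 1 \<and> eps i \<noteq> 0} \<and>
       (a0 = 0 \<longrightarrow> 0 < (\<Sum>i\<in>{i. i \<ge> 1 \<and> eps i \<noteq> 0}. eps i))}"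

end

theory Submission
  imports Defs "HOL-Computational_Algebra.Nth_Powers"
begin

text \<open>
  Fix an element \<open>c \<ge> 2\<close> of the cube. By the pigeonhole principle, infinitely many partial
  sums of the remaining generators agree modulo \<open>c\<^sup>2\<close>, so there are many cube elements
  \<open>c + N\<close> with \<open>c\<^sup>2\<close> dividing \<open>N\<close>. Such an element is \<open>c (1 + c t)\<close> with coprime factors;
  if it is a \<open>k\<close>-th power, then so is \<open>c\<close>, and hence \<open>k < c\<close>. Among \<open>c + 1\<close> arbitrarily
  large elements of this kind with bounded differences, two must be powers with the same
  exponent, which is impossible because the gaps between consecutive \<open>k\<close>-th powers tend to
  infinity.
\<close>

text \<open>For \<open>k > 0\<close>, the coprime splitting \<open>c * (1 + c * t)\<close> forces
  \<open>c = u ^ k\<close> with \<open>u \<ge> 2\<close>, so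
  \<open>k < 2 ^ k \<le> c\<close>.\<close>

lemma exponent_less_of_shifted_power:
  fixes c t x k :: nat
  assumes "c \<ge> 2" and "c + c\<^sup>2 * t = x ^ k"
  shows "k < c"
proof (cases "k = 0")
  case False
  have "c * (1 + c * t) = x ^ k"
    using assms(2) by (simp add: power2_eq_square algebra_simps)
  hence "is_nth_power k (c * (1 + c * t))"
    by (auto simp: is_nth_power_def)
  moreover have "coprime c (1 + c * t)"
    by (metis coprime_1_right coprime_iff_gcd_eq_1 gcd_add_mult add.commute mult.commute)
  ultimately have "is_nth_power k c"
    using is_nth_power_mult_coprime_natD(1) assms(1) by fastforce
  then obtain u where u: "c = u ^ k"
    by (auto simp: is_nth_power_def)
  have "u \<noteq> 0" "u \<noteq> 1"
    using u assms(1) False by (auto intro!: Nat.gr0I simp: power_0_left)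
  hence "2 ^ k \<le> u ^ k"
    by (intro power_mono) auto
  thus ?thesis
    using u less_exp[of k] by linarith
qed (use assms in simp)

text \<open>Quantitative form of the growing gaps: a bounded difference of two distinct
  \<open>k\<close>-th powers bounds the smaller base.\<close>

lemma power_gap:
  fixes x y k :: nat
  assumes "x < y" and "k \<ge> 2"
  shows "x ^ k + x \<le> y ^ k"
proof -
  obtain l where l: "k = Suc (Suc l)"
    using assms(2) by (metis add_2_eq_Suc le_Suc_ex)
  have "x \<le> x ^ Suc l"
    by (cases "x = 0") (auto simp: self_le_power simp del: power_Suc)
  hence "x ^ k + x \<le> (x + 1) * x ^ Suc l"
    by (simp add: l)
  also have "\<dots> \<le> y * y ^ Suc l"
    using assms(1) by (intro mult_mono power_mono) auto
  finally show ?thesis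
    by (simp add: l)
qed

text \<open>Differences of \<open>P\<close> model sums over blocks of consecutive generators, with
  \<open>P\<close> their partial sums.\<close>

lemma no_power_differences:
  fixes c :: nat and P :: "nat \<Rightarrow> nat"
  assumes c: "c \<ge> 2" and P: "strict_mono P"
    and pow: "\<And>m n. m < n \<Longrightarrow> \<exists>x k. 2 \<le> k \<and> c + (P n - P m) = x ^ k"
  shows False
proof -
  have "finite ((\<lambda>n. P n mod c\<^sup>2) ` UNIV)"
    by (rule finite_subset[of _ "{..<c\<^sup>2}"]) (use c in auto)
  then obtain n0 where "infinite {n \<in> UNIV. P n mod c\<^sup>2 = P n0 mod c\<^sup>2}"
    using pigeonhole_infinite[of UNIV "\<lambda>n. P n mod c\<^sup>2"] by auto
  then obtain I where I: "infinite I" "\<And>n. n \<in> I \<Longrightarrow> P n mod c\<^sup>2 = P n0 mod c\<^sup>2"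
    by force
  \<comment> \<open>More indices than the at most \<open>c\<close> exponents below \<open>c\<close>,
    so two of them must share an exponent.\<close>
  obtain J where J: "J \<subseteq> I" "finite J" "card J = c + 1"
    using infinite_arbitrarily_large[OF I(1)] by metis
  define S where "S = P (Max J)"
  have S: "P m \<le> S" if "m \<in> J" for m
    unfolding S_def using P J(2) that by (simp add: strict_mono_less_eq)
  \<comment> \<open>Since \<open>L \<le> P L\<close>, this makes every
    \<open>c + (P L - P m)\<close> with \<open>m\<close> in \<open>J\<close> exceed
    \<open>(S + 1) ^ c\<close>.\<close>
  obtain L where L: "L \<in> I" "L > Max J + S + (S + 1) ^ c"
    using I(1) unfolding finite_nat_set_iff_bounded_le by (meson not_le_imp_less)
  have less_L: "m < L" if "m \<in> J" for m
    using Max_ge[OF J(2) that] L(2) by linarith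
  have "\<exists>x k. 2 \<le> k \<and> k < c \<and> c + (P L - P m) = x ^ k" if m: "m \<in> J" for m
  proof -
    obtain x k where xk: "2 \<le> k" "c + (P L - P m) = x ^ k"
      using pow[OF less_L[OF m]] by auto
    have "P L mod c\<^sup>2 = P m mod c\<^sup>2"
      using I(2) L(1) J(1) m by (metis subsetD)
    hence "c\<^sup>2 dvd P L - P m"
      by (rule mod_eq_dvd_iff_nat[THEN iffD1, rotated])
         (use P less_L[OF m] in \<open>simp add: strict_mono_less_eq\<close>)
    then obtain t where "P L - P m = c\<^sup>2 * t"
      by (elim dvdE)
    thus ?thesis
      using xk exponent_less_of_shifted_power[OF c] by metis
  qed
  then obtain x k where xk:
    "\<And>m. m \<in> J \<Longrightarrow> 2 \<le> k m \<and> k m < c \<and> c + (P L - P m) = x m ^ k m"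
    by metis
  have "\<not> inj_on k J"
  proof
    assume "inj_on k J"
    moreover have "k ` J \<subseteq> {..<c}"
      using xk by auto
    ultimately have "card J \<le> card {..<c}"
      by (intro card_inj_on_le) auto
    thus False
      using J(3) by simp
  qed
  then obtain m n where mn: "m \<in> J" "n \<in> J" "m < n" "k m = k n"
    unfolding inj_on_def by (metis linorder_neqE_nat)
  have PL: "P n < P L" "P m < P n" "L \<le> P L"
    using P mn less_L by (auto simp: strict_mono_less strict_mono_imp_increasing)
  have eq: "c + (P L - P m) = x m ^ k n" "c + (P L - P n) = x n ^ k n" "2 \<le> k n" "k n < c"
    using xk[OF mn(1)] xk[OF mn(2)] mn(4) by auto
  have "x n ^ k n < x m ^ k n"
    using eq PL by linarith
  hence "x n < x m"
    by (rule power_less_imp_less_base) simp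
  hence "x n ^ k n + x n \<le> x m ^ k n"
    using eq(3) by (rule power_gap)
  \<comment> \<open>The two powers differ by exactly \<open>P n - P m\<close>, which is at most
    \<open>S\<close>.\<close>
  hence "x n \<le> S"
    using eq PL S[OF mn(2)] by linarith
  \<comment> \<open>The base \<open>S + 1\<close> is at least 1 even if \<open>S = 0\<close>, so the
    exponent may be raised to \<open>c\<close>.\<close>
  hence "x n ^ k n \<le> (S + 1) ^ k n"
    by (intro power_mono) auto
  also have "\<dots> \<le> (S + 1) ^ c"
    using eq(4) by (intro power_increasing) auto
  finally show False
    using eq(2) PL S[OF mn(2)] L(2) by linarith
qed

text \<open>The indicator function of \<open>A\<close> serves as \<open>eps\<close>; nonemptiness of
  \<open>A\<close> covers the extra condition for \<open>a0 = 0\<close>.\<close>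

lemma subset_sum_in_hilbert_cube:
  assumes "finite A" and "A \<noteq> {}" and "A \<subseteq> {1..}"
  shows "a0 + sum a A \<in> hilbert_cube a0 a"
proof -
  define eps :: "nat \<Rightarrow> int" where "eps i = (if i \<in> A then 1 else 0)" for i
  have supp: "{i. i \<ge> 1 \<and> eps i \<noteq> 0} = A"
    using assms(3) by (auto simp: eps_def)
  have "(\<Sum>i\<in>A. eps i * a i) = sum a A" "(\<Sum>i\<in>A. eps i) = int (card A)"
    by (simp_all add: eps_def)
  moreover have "card A > 0"
    using assms by (simp add: card_gt_0_iff)
  moreover have "\<forall>i\<ge>1. eps i \<in> {0, 1}"
    by (simp add: eps_def)
  ultimately show ?thesis
    unfolding hilbert_cube_def using assms(1) supp
    by (intro CollectI exI[of _ eps]) simp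
qed

theorem theorem5:
  shows "\<not> (\<exists>(a0 :: int) (a :: nat \<Rightarrow> int).
            a0 \<ge> 0 \<and> (\<forall>i\<ge>1. a i > 0) \<and> hilbert_cube a0 a \<subseteq> pure_powers)"
proof
  assume "\<exists>(a0 :: int) (a :: nat \<Rightarrow> int).
            a0 \<ge> 0 \<and> (\<forall>i\<ge>1. a i > 0) \<and> hilbert_cube a0 a \<subseteq> pure_powers"
  then obtain a0 :: int and a :: "nat \<Rightarrow> int"
    where a0: "a0 \<ge> 0" and pos: "\<And>i. i \<ge> 1 \<Longrightarrow> a i > 0"
      and sub: "hilbert_cube a0 a \<subseteq> pure_powers"
    by blast
  \<comment> \<open>Two positive generators ensure \<open>c \<ge> 2\<close> even for
    \<open>a0 = 0\<close>; the partial sums \<open>P\<close> start at index 3 to avoid reusing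
    them.\<close>
  define c where "c = nat (a0 + a 1 + a 2)"
  define P where "P n = (\<Sum>i\<in>{3..<n + 3}. nat (a i))" for n
  have c: "int c = a0 + a 1 + a 2" "c \<ge> 2"
    unfolding c_def using a0 pos[of 1] pos[of 2] by auto
  show False
  proof (rule no_power_differences)
    show "c \<ge> 2"
      by (fact c)
    show "strict_mono P"
      unfolding strict_mono_Suc_iff
    proof
      fix n
      have "P (Suc n) = P n + nat (a (n + 3))"
        unfolding P_def add_Suc by (rule sum.atLeastLessThan_Suc) simp
      thus "P n < P (Suc n)"
        using pos by simp
    qed
  next
    fix m n :: nat
    assume "m < n"
    define B where "B = {m + 3..<n + 3}"
    have "{3..<n + 3} = {3..<m + 3} \<union> B"
      using \<open>m < n\<close> by (auto simp: B_def)
    hence "P n = P m + (\<Sum>i\<in>B. nat (a i))"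
      unfolding P_def by (subst sum.union_disjoint[symmetric]) (auto simp: B_def)
    hence "int (P n - P m) = (\<Sum>i\<in>B. int (nat (a i)))"
      by simp
    also have "\<dots> = sum a B"
      using pos by (intro sum.cong) (auto simp: B_def less_imp_le)
    finally have "int (c + (P n - P m)) = a0 + sum a ({1, 2} \<union> B)"
      by (subst sum.union_disjoint) (auto simp: B_def c)
    also have "\<dots> \<in> pure_powers"
      by (rule subsetD[OF sub], rule subset_sum_in_hilbert_cube) (auto simp: B_def)
    finally obtain x k :: nat where "k \<ge> 2" "int (c + (P n - P m)) = int x ^ k"
      unfolding pure_powers_def by blast
    thus "\<exists>x k. 2 \<le> k \<and> c + (P n - P m) = x ^ k"
      by (metis of_nat_eq_iff of_nat_power)
  qed
qed

end
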